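(* Let $(X,R,S,E)$ be a finitely decomposable relational interchange monoid and let $(K,+,\bullet,\diamond,0,1)$ be an interchange semiring. Then $K^X$, with pointwise addition, the constant function $0$, the convolutions $(f\ast g)(x)=\sum\{f(y)\bullet g(z)\mid R^x_{yz}\}$ and $(f\circledast g)(x)=\sum\{f(y)\diamond g(z)\mid S^x_{yz}\}$ (finite sums), and the unit $\mathit{id}_E$ ($\mathit{id}_E(x)=1$ if $x\in E$, $0$ otherwise), is an interchange semiring.
   Context: Write $R^x_{yz}$ for a ternary relation $R$ on $X$ holding at $(x,y,z)$. $R$ is relationally associative if for all $x,u,v,w$: $(\exists y.\ R^y_{uv}\wedge R^x_{yw})\Leftrightarrow(\exists y.\ R^x_{uy}\wedge R^y_{vw})$. $E\subseteq X$ is a set of relational units for $R$ if for all $x,y$: $\exists e\in E.\ R^x_{ex}$; $R^x_{ey}\wedge e\in E\Rightarrow x=y$; $\exists e\in E.\ R^x_{xe}$; $R^x_{ye}\wedge e\in E\Rightarrow x=y$. A relational interchange monoid $(X,R,S,E)$: $R,S$ relationally associative ternary relations on $X$, both with set of relational units $E$, satisfying for all $t,u,v,w,x$: $(\exists y,z.\ S^y_{tu}\wedge R^x_{yz}\wedge S^z_{vw})\Rightarrow(\exists y,z.\ R^y_{tv}\wedge S^x_{yz}\wedge R^z_{uw})$. It is finitely decomposable if for every $x$ the sets $\{(y,z)\mid R^x_{yz}\}$ and $\{(y,z)\mid S^x_{yz}\}$ are finite. A dioid is a semiring $(K,+,\cdot,0,1)$ with idempotent addition, ordered by $a\le b\iff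 a+b=b$. An interchange semiring $(K,+,\bullet,\diamond,0,1)$ is such that $(K,+,\bullet,0,1)$ and $(K,+,\diamond,0,1)$ are dioids and $(a\diamond b)\bullet(c\diamond d)\le(a\bullet c)\diamond(b\bullet d)$ for all $a,b,c,d$. *)

theory Defs
  imports "HOL-Algebra.Ring"
begin

text \<open>
  A ternary relation on \<open>X\<close> is a subset of \<open>X \<times> X \<times> X\<close>, and \<open>(x, y, z) \<in> R\<close> stands for
  \<open>R\<close> with upper index \<open>x\<close> and lower indices \<open>y z\<close>.
\<close>

definition rel_associative :: "'x set \<Rightarrow> ('x \<times> 'x \<times> 'x) set \<Rightarrow> bool" where
  "rel_associative X R \<longleftrightarrow>
    (\<forall>x\<in>X. \<forall>u\<in>X. \<forall>v\<in>X. \<forall>w\<in>X.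
      (\<exists>y\<in>X. (y, u, v) \<in> R \<and> (x, y, w) \<in> R) \<longleftrightarrow>
      (\<exists>y\<in>X. (x, u, y) \<in> R \<and> (y, v, w) \<in> R))"

definition rel_units :: "'x set \<Rightarrow> ('x \<times> 'x \<times> 'x) set \<Rightarrow> 'x set \<Rightarrow> bool" where
  "rel_units X R E \<longleftrightarrow>
    E \<subseteq> X \<and>
    (\<forall>x\<in>X. \<exists>e\<in>E. (x, e, x) \<in> R) \<and>
    (\<forall>x\<in>X. \<forall>y\<in>X. \<forall>e\<in>E. (x, e, y) \<in> R \<longrightarrow> x = y) \<and>
    (\<forall>x\<in>X. \<exists>e\<in>E. (x, x, e) \<in> R) \<and>
    (\<forall>x\<in>X. \<forall>y\<in>X. \<forall>e\<in>E. (x, y, e) \<in> R \<longrightarrow> x = y)"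

locale rel_interchange_monoid =
  fixes X :: "'x set" and R S :: "('x \<times> 'x \<times> 'x) set" and E :: "'x set"
  assumes R_on: "R \<subseteq> X \<times> X \<times> X"
    and S_on: "S \<subseteq> X \<times> X \<times> X"
    and R_assoc: "rel_associative X R"
    and S_assoc: "rel_associative X S"
    and R_units: "rel_units X R E"
    and S_units: "rel_units X S E"
    and rel_interchange:
      "\<lbrakk>t \<in> X; u \<in> X; v \<in> X; w \<in> X; x \<in> X;
        \<exists>y\<in>X. \<exists>z\<in>X. (y, t, u) \<in> S \<and> (x, y, z) \<in> R \<and> (z, v, w) \<in> S\<rbrakk> \<Longrightarrow>
       \<exists>y\<in>X. \<exists>z\<in>X. (y, t, v) \<in> R \<and> (x, y, z) \<in> S \<and> (z, u, w) \<in> R"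

definition finitely_decomposable ::
    "'x set \<Rightarrow> ('x \<times> 'x \<times> 'x) set \<Rightarrow> ('x \<times> 'x \<times> 'x) set \<Rightarrow> bool" where
  "finitely_decomposable X R S \<longleftrightarrow>
    (\<forall>x\<in>X. finite {(y, z). (x, y, z) \<in> R} \<and> finite {(y, z). (x, y, z) \<in> S})"

locale dioid = semiring K for K (structure) +
  assumes add_idem: "a \<in> carrier K \<Longrightarrow> a \<oplus> a = a"

definition dioid_le :: "('k, 'm) ring_scheme \<Rightarrow> 'k \<Rightarrow> 'k \<Rightarrow> bool" where
  "dioid_le K a b \<longleftrightarrow> a \<oplus>\<^bsub>K\<^esub> b = b"

text \<open>
  The ring multiplication \<open>\<otimes>\<close> plays the role of the first product (the bullet); the record
  is extended by the second product.
\<close>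

record 'k interchange_struct = "'k ring" +
  diamond :: "'k \<Rightarrow> 'k \<Rightarrow> 'k" (infixl \<open>\<diamondop>\<index>\<close> 70)

locale interchange_semiring =
  fixes K :: "('k, 'm) interchange_struct_scheme" (structure)
  assumes bullet_dioid: "dioid K"
    and diamond_dioid: "dioid (K\<lparr>mult := diamond K\<rparr>)"
    and interchange:
      "\<lbrakk>a \<in> carrier K; b \<in> carrier K; c \<in> carrier K; d \<in> carrier K\<rbrakk> \<Longrightarrow>
       dioid_le K ((a \<diamondop> b) \<otimes> (c \<diamondop> d)) ((a \<otimes> c) \<diamondop> (b \<otimes> d))"

definition convolution ::
    "'x set \<Rightarrow> ('x \<times> 'x \<times> 'x) set \<Rightarrow> ('k, 'm) ring_scheme \<Rightarrow> ('k \<Rightarrow> 'k \<Rightarrow> 'k) \<Rightarrow>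
     ('x \<Rightarrow> 'k) \<Rightarrow> ('x \<Rightarrow> 'k) \<Rightarrow> 'x \<Rightarrow> 'k" where
  "convolution X R K m f g =
    (\<lambda>x\<in>X. finsum K (\<lambda>(y, z). m (f y) (g z)) {(y, z). (x, y, z) \<in> R})"

definition unit_fun :: "'x set \<Rightarrow> 'x set \<Rightarrow> ('k, 'm) ring_scheme \<Rightarrow> 'x \<Rightarrow> 'k" where
  "unit_fun X E K = (\<lambda>x\<in>X. if x \<in> E then \<one>\<^bsub>K\<^esub> else \<zero>\<^bsub>K\<^esub>)"

text \<open>
  The function space \<open>K\<^sup>X\<close> consists of the extensional functions, so that functions are
  identified exactly when they agree on \<open>X\<close>.
\<close>

definition convolution_algebra ::
    "'x set \<Rightarrow> ('x \<times> 'x \<times> 'x) set \<Rightarrow> ('x \<times> 'x \<times> 'x) set \<Rightarrow> 'x set \<Rightarrow>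
     ('k, 'm) interchange_struct_scheme \<Rightarrow> ('x \<Rightarrow> 'k) interchange_struct" where
  "convolution_algebra X R S E K =
    \<lparr>carrier = X \<rightarrow>\<^sub>E carrier K,
     mult = convolution X R K (mult K),
     one = unit_fun X E K,
     zero = (\<lambda>x\<in>X. \<zero>\<^bsub>K\<^esub>),
     add = (\<lambda>f g. \<lambda>x\<in>X. f x \<oplus>\<^bsub>K\<^esub> g x),
     diamond = convolution X S K (diamond K)\<rparr>"

end

theory Submission
  imports Defs
begin

text \<open>
  Addition is idempotent, so a finite sum is the least upper bound of its summands, and an
  element is determined by its upper bounds. Since products distribute over finite sums, an
  iterated convolution at \<open>x\<close> lies below \<open>c\<close> iff the product attached to every iterated
  decomposition of \<open>x\<close> lies below \<open>c\<close>. Each semiring axiom of \<open>K\<^sup>X\<close> thus reduces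
  to a correspondence between decompositions, and no sums have to be reindexed.
\<close>

section \<open>The natural order of a dioid and upper bounds of finite sums\<close>

context dioid
begin

lemma le_refl: "a \<in> carrier K \<Longrightarrow> dioid_le K a a"
  by (simp add: dioid_le_def add_idem)

lemma le_trans:
  assumes "dioid_le K a b" "dioid_le K b c"
    and "a \<in> carrier K" "b \<in> carrier K" "c \<in> carrier K"
  shows "dioid_le K a c"
  using assms unfolding dioid_le_def by (metis a_assoc)

lemma zero_le: "a \<in> carrier K \<Longrightarrow> dioid_le K \<zero> a"
  by (simp add: dioid_le_def)

text \<open>Testing with \<open>c = b\<close> and \<open>c = a\<close>, reflexivity makes
  \<open>a\<close> and \<open>b\<close> lie below each other. Then both equal
  \<open>a \<oplus> b\<close> by commutativity.\<close>

lemma eq_if_same_upper_bounds: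
  assumes "\<And>c. c \<in> carrier K \<Longrightarrow> dioid_le K a c \<longleftrightarrow> dioid_le K b c"
    and "a \<in> carrier K" "b \<in> carrier K"
  shows "a = b"
  using assms le_refl unfolding dioid_le_def by (metis a_comm)

text \<open>The forward direction is absorption: since \<open>a \<oplus> (a \<oplus> b \<oplus> c) =
  a \<oplus> b \<oplus> c\<close> by idempotence, any \<open>c\<close> that absorbs the sum absorbs
  \<open>a\<close>, and likewise \<open>b\<close>.\<close>

lemma add_le_iff:
  assumes "a \<in> carrier K" "b \<in> carrier K" "c \<in> carrier K"
  shows "dioid_le K (a \<oplus> b) c \<longleftrightarrow> dioid_le K a c \<and> dioid_le K b c"
proof -
  have "a \<oplus> b \<oplus> c = c \<Longrightarrow> a \<oplus> c = c" "a \<oplus> b \<oplus> c = c \<Longrightarrow> b \<oplus> c = c"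
    using assms add_idem a_assoc a_comm a_closed by metis+
  then show ?thesis
    using assms by (auto simp: dioid_le_def a_assoc)
qed

lemma finsum_le_iff:
  assumes "finite A" "F \<in> A \<rightarrow> carrier K" "c \<in> carrier K"
  shows "dioid_le K (finsum K F A) c \<longleftrightarrow> (\<forall>a\<in>A. dioid_le K (F a) c)"
  using assms
proof (induction A rule: finite_induct)
  case empty
  then show ?case by (simp add: zero_le)
next
  case (insert a A)
  then have "F \<in> A \<rightarrow> carrier K" "F a \<in> carrier K" by auto
  with insert show ?case by (simp add: add_le_iff finsum_closed)
qed

lemma finsum_mult_le_iff:
  assumes "finite A" "F \<in> A \<rightarrow> carrier K" "d \<in> carrier K" "c \<in> carrier K"
  shows "dioid_le K (finsum K F A \<otimes> d) c \<longleftrightarrow> (\<forall>a\<in>A. dioid_le K (F a \<otimes> d) c)"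
  using assms by (simp add: finsum_ldistr finsum_le_iff Pi_def)

lemma mult_finsum_le_iff:
  assumes "finite A" "F \<in> A \<rightarrow> carrier K" "d \<in> carrier K" "c \<in> carrier K"
  shows "dioid_le K (d \<otimes> finsum K F A) c \<longleftrightarrow> (\<forall>a\<in>A. dioid_le K (d \<otimes> F a) c)"
  using assms by (simp add: finsum_rdistr finsum_le_iff Pi_def)

text \<open>If \<open>a \<oplus> b = b\<close>, distributivity gives
  \<open>a \<otimes> c \<oplus> b \<otimes> c = b \<otimes> c\<close>. The two factors are enlarged
  one after the other.\<close>

lemma mult_mono:
  assumes "dioid_le K a b" "dioid_le K c d"
    and "a \<in> carrier K" "b \<in> carrier K" "c \<in> carrier K" "d \<in> carrier K"
  shows "dioid_le K (a \<otimes> c) (b \<otimes> d)"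
proof -
  have "dioid_le K (a \<otimes> c) (b \<otimes> c)"
    using assms by (metis dioid_le_def l_distr)
  moreover have "dioid_le K (b \<otimes> c) (b \<otimes> d)"
    using assms by (metis dioid_le_def r_distr)
  ultimately show ?thesis
    using assms by (auto intro: le_trans)
qed

end

section \<open>Convolution along one relation and its upper bounds\<close>

locale decomposition_dioid = dioid K for K (structure) +
  fixes X :: "'x set" and R :: "('x \<times> 'x \<times> 'x) set"
  assumes rel_on: "R \<subseteq> X \<times> X \<times> X"
    and finite_decompositions: "x \<in> X \<Longrightarrow> finite {(y, z). (x, y, z) \<in> R}"
begin

lemma rel_in: "(x, y, z) \<in> R \<Longrightarrow> x \<in> X \<and> y \<in> X \<and> z \<in> X"
  using rel_on by blast

text \<open>The operation \<open>m\<close> inside the convolution is kept apart from the product of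
  \<open>K\<close>. The interchange law needs this: there a diamond convolution occurs as a factor
  of a bullet product.\<close>

context
  fixes m f g
  assumes m_closed: "\<And>a b. a \<in> carrier K \<Longrightarrow> b \<in> carrier K \<Longrightarrow> m a b \<in> carrier K"
    and f_in: "f \<in> X \<rightarrow>\<^sub>E carrier K"
    and g_in: "g \<in> X \<rightarrow>\<^sub>E carrier K"
begin

lemma summand_in: "(\<lambda>(y, z). m (f y) (g z)) \<in> {(y, z). (x, y, z) \<in> R} \<rightarrow> carrier K"
  using PiE_mem[OF f_in] PiE_mem[OF g_in] by (auto intro!: m_closed dest: rel_in)

lemma convolution_closed: "x \<in> X \<Longrightarrow> convolution X R K m f g x \<in> carrier K"
  using summand_in by (simp add: convolution_def finsum_closed)

lemma convolution_in: "convolution X R K m f g \<in> X \<rightarrow>\<^sub>E carrier K"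
  using convolution_closed by (auto simp: convolution_def)

lemma convolution_le_iff:
  assumes "x \<in> X" "c \<in> carrier K"
  shows "dioid_le K (convolution X R K m f g x) c \<longleftrightarrow>
    (\<forall>y z. (x, y, z) \<in> R \<longrightarrow> dioid_le K (m (f y) (g z)) c)"
  using finsum_le_iff[OF finite_decompositions summand_in] assms
  by (auto simp: convolution_def)

lemma convolution_mult_le_iff:
  assumes "x \<in> X" "d \<in> carrier K" "c \<in> carrier K"
  shows "dioid_le K (convolution X R K m f g x \<otimes> d) c \<longleftrightarrow>
    (\<forall>y z. (x, y, z) \<in> R \<longrightarrow> dioid_le K (m (f y) (g z) \<otimes> d) c)"
  using finsum_mult_le_iff[OF finite_decompositions summand_in] assms
  by (auto simp: convolution_def)

lemma mult_convolution_le_iff: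
  assumes "x \<in> X" "d \<in> carrier K" "c \<in> carrier K"
  shows "dioid_le K (d \<otimes> convolution X R K m f g x) c \<longleftrightarrow>
    (\<forall>y z. (x, y, z) \<in> R \<longrightarrow> dioid_le K (d \<otimes> m (f y) (g z)) c)"
  using mult_finsum_le_iff[OF finite_decompositions summand_in] assms
  by (auto simp: convolution_def)

lemma summand_le_convolution:
  assumes "(x, y, z) \<in> R"
  shows "dioid_le K (m (f y) (g z)) (convolution X R K m f g x)"
  using assms rel_in convolution_le_iff convolution_closed le_refl by blast

end

abbreviation conv (infixl \<open>\<star>\<close> 70) where
  "f \<star> g \<equiv> convolution X R K (mult K) f g"

lemmas conv_closed [simp] = convolution_closed[of "mult K", OF m_closed]
  and conv_in [simp] = convolution_in[of "mult K", OF m_closed]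
  and conv_le_iff = convolution_le_iff[of "mult K", OF m_closed]
  and conv_mult_le_iff = convolution_mult_le_iff[of "mult K", OF m_closed]
  and mult_conv_le_iff = mult_convolution_le_iff[of "mult K", OF m_closed]

section \<open>The dioid axioms for functions under convolution\<close>

lemma function_eqI:
  assumes "f \<in> X \<rightarrow>\<^sub>E carrier K" "g \<in> X \<rightarrow>\<^sub>E carrier K"
    and "\<And>x c. x \<in> X \<Longrightarrow> c \<in> carrier K \<Longrightarrow> dioid_le K (f x) c \<longleftrightarrow> dioid_le K (g x) c"
  shows "f = g"
proof (rule PiE_ext[OF assms(1,2)])
  show "f x = g x" if "x \<in> X" for x
    using that assms by (blast intro: eq_if_same_upper_bounds)
qed

lemma conv_assoc:
  assumes assoc: "rel_associative X R"
    and f: "f \<in> X \<rightarrow>\<^sub>E carrier K" and g: "g \<in> X \<rightarrow>\<^sub>E carrier K" and h: "h \<in> X \<rightarrow>\<^sub>E carrier K"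
  shows "(f \<star> g) \<star> h = f \<star> (g \<star> h)"
proof (rule function_eqI)
  fix x c assume x: "x \<in> X" and c: "c \<in> carrier K"
  note fgh = PiE_mem[OF f] PiE_mem[OF g] PiE_mem[OF h]
  have assoc_iff: "(\<exists>y. (y, u, v) \<in> R \<and> (x, y, w) \<in> R) \<longleftrightarrow>
      (\<exists>y. (x, u, y) \<in> R \<and> (y, v, w) \<in> R)" for u v w
    using assoc x unfolding rel_associative_def by (smt (verit) rel_in)
  have "dioid_le K (((f \<star> g) \<star> h) x) c \<longleftrightarrow>
      (\<forall>y w. (x, y, w) \<in> R \<longrightarrow>
        (\<forall>u v. (y, u, v) \<in> R \<longrightarrow> dioid_le K (f u \<otimes> g v \<otimes> h w) c))"
    \<comment> \<open>With \<open>imp_cong\<close>, membership in \<open>R\<close> is available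
      while the conclusion is rewritten. It puts the points in \<open>X\<close> and hence the
      function values in the carrier.\<close>
    using x c f g h fgh rel_in by (simp add: conv_le_iff conv_mult_le_iff cong: imp_cong)
  also have "\<dots> \<longleftrightarrow>
      (\<forall>u y. (x, u, y) \<in> R \<longrightarrow>
        (\<forall>v w. (y, v, w) \<in> R \<longrightarrow> dioid_le K (f u \<otimes> g v \<otimes> h w) c))"
    \<comment> \<open>The inequality does not mention the intermediate point \<open>y\<close>, so
      both sides quantify over the same triples \<open>u\<close>, \<open>v\<close>,
      \<open>w\<close>.\<close>
    using assoc_iff by blast
  also have "\<dots> \<longleftrightarrow>
      (\<forall>u y. (x, u, y) \<in> R \<longrightarrow>
        (\<forall>v w. (y, v, w) \<in> R \<longrightarrow> dioid_le K (f u \<otimes> (g v \<otimes> h w)) c))"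
    using fgh rel_in by (simp add: m_assoc cong: imp_cong)
  also have "\<dots> \<longleftrightarrow> dioid_le K ((f \<star> (g \<star> h)) x) c"
    using x c f g h fgh rel_in by (simp add: conv_le_iff mult_conv_le_iff cong: imp_cong)
  finally show "dioid_le K (((f \<star> g) \<star> h) x) c \<longleftrightarrow> dioid_le K ((f \<star> (g \<star> h)) x) c" .
qed (use f g h in simp_all)

lemma unit_fun_in [simp]: "unit_fun X E K \<in> X \<rightarrow>\<^sub>E carrier K"
  by (auto simp: unit_fun_def)

lemma unit_conv:
  assumes units: "rel_units X R E" and f: "f \<in> X \<rightarrow>\<^sub>E carrier K"
  shows "unit_fun X E K \<star> f = f"
proof (rule function_eqI)
  fix x c assume x: "x \<in> X" and c: "c \<in> carrier K"
  note f' = PiE_mem[OF f]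
  have "dioid_le K ((unit_fun X E K \<star> f) x) c \<longleftrightarrow>
      (\<forall>y z. (x, y, z) \<in> R \<longrightarrow> dioid_le K (unit_fun X E K y \<otimes> f z) c)"
    using x c f by (simp add: conv_le_iff)
  \<comment> \<open>For \<open>y\<close> outside \<open>E\<close> the summand is zero, which lies
    below every \<open>c\<close>; for \<open>y\<close> in \<open>E\<close> the factor is
    one.\<close>
  also have "\<dots> \<longleftrightarrow> (\<forall>y z. (x, y, z) \<in> R \<longrightarrow> y \<in> E \<longrightarrow> dioid_le K (f z) c)"
    using f' c rel_in by (simp add: unit_fun_def zero_le cong: imp_cong) blast
  \<comment> \<open>Every remaining decomposition has \<open>z = x\<close>, and the existence of a
    left unit of \<open>x\<close> ensures that there is at least one.\<close>
  also have "\<dots> \<longleftrightarrow> dioid_le K (f x) c"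
    using units x rel_in unfolding rel_units_def by metis
  finally show "dioid_le K ((unit_fun X E K \<star> f) x) c \<longleftrightarrow> dioid_le K (f x) c" .
qed (use f in simp_all)

lemma conv_unit:
  assumes units: "rel_units X R E" and f: "f \<in> X \<rightarrow>\<^sub>E carrier K"
  shows "f \<star> unit_fun X E K = f"
proof (rule function_eqI)
  fix x c assume x: "x \<in> X" and c: "c \<in> carrier K"
  note f' = PiE_mem[OF f]
  have "dioid_le K ((f \<star> unit_fun X E K) x) c \<longleftrightarrow>
      (\<forall>y z. (x, y, z) \<in> R \<longrightarrow> dioid_le K (f y \<otimes> unit_fun X E K z) c)"
    using x c f by (simp add: conv_le_iff)
  also have "\<dots> \<longleftrightarrow> (\<forall>y z. (x, y, z) \<in> R \<longrightarrow> z \<in> E \<longrightarrow> dioid_le K (f y) c)"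
    using f' c rel_in by (simp add: unit_fun_def zero_le cong: imp_cong) blast
  also have "\<dots> \<longleftrightarrow> dioid_le K (f x) c"
    using units x rel_in unfolding rel_units_def by metis
  finally show "dioid_le K ((f \<star> unit_fun X E K) x) c \<longleftrightarrow> dioid_le K (f x) c" .
qed (use f in simp_all)

lemma fun_add_in:
  "\<lbrakk>f \<in> X \<rightarrow>\<^sub>E carrier K; g \<in> X \<rightarrow>\<^sub>E carrier K\<rbrakk> \<Longrightarrow> (\<lambda>x\<in>X. f x \<oplus> g x) \<in> X \<rightarrow>\<^sub>E carrier K"
  by (auto dest: PiE_mem)

lemma conv_distrib_right:
  assumes f: "f \<in> X \<rightarrow>\<^sub>E carrier K" and g: "g \<in> X \<rightarrow>\<^sub>E carrier K" and h: "h \<in> X \<rightarrow>\<^sub>E carrier K"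
  shows "(\<lambda>x\<in>X. f x \<oplus> g x) \<star> h = (\<lambda>x\<in>X. (f \<star> h) x \<oplus> (g \<star> h) x)"
proof (rule function_eqI)
  fix x c assume x: "x \<in> X" and c: "c \<in> carrier K"
  note fgh = PiE_mem[OF f] PiE_mem[OF g] PiE_mem[OF h]
  have "dioid_le K (((\<lambda>x\<in>X. f x \<oplus> g x) \<star> h) x) c \<longleftrightarrow>
      (\<forall>y z. (x, y, z) \<in> R \<longrightarrow> dioid_le K (f y \<otimes> h z) c \<and> dioid_le K (g y \<otimes> h z) c)"
    using x c f g h fgh rel_in
    by (simp add: conv_le_iff fun_add_in l_distr add_le_iff cong: imp_cong)
  \<comment> \<open>The universal quantifier distributes over the conjunction, one conjunct for each
    of the two convolutions.\<close>
  also have "\<dots> \<longleftrightarrow> dioid_le K ((\<lambda>x\<in>X. (f \<star> h) x \<oplus> (g \<star> h) x) x) c"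
    using x c f g h by (auto simp: conv_le_iff add_le_iff)
  finally show "dioid_le K (((\<lambda>x\<in>X. f x \<oplus> g x) \<star> h) x) c \<longleftrightarrow>
    dioid_le K ((\<lambda>x\<in>X. (f \<star> h) x \<oplus> (g \<star> h) x) x) c" .
next
  show "(\<lambda>x\<in>X. f x \<oplus> g x) \<star> h \<in> X \<rightarrow>\<^sub>E carrier K"
    by (intro conv_in fun_add_in f g h)
  show "(\<lambda>x\<in>X. (f \<star> h) x \<oplus> (g \<star> h) x) \<in> X \<rightarrow>\<^sub>E carrier K"
    by (rule fun_add_in) (simp_all add: f g h)
qed

lemma conv_distrib_left:
  assumes f: "f \<in> X \<rightarrow>\<^sub>E carrier K" and g: "g \<in> X \<rightarrow>\<^sub>E carrier K" and h: "h \<in> X \<rightarrow>\<^sub>E carrier K"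
  shows "h \<star> (\<lambda>x\<in>X. f x \<oplus> g x) = (\<lambda>x\<in>X. (h \<star> f) x \<oplus> (h \<star> g) x)"
proof (rule function_eqI)
  fix x c assume x: "x \<in> X" and c: "c \<in> carrier K"
  note fgh = PiE_mem[OF f] PiE_mem[OF g] PiE_mem[OF h]
  have "dioid_le K ((h \<star> (\<lambda>x\<in>X. f x \<oplus> g x)) x) c \<longleftrightarrow>
      (\<forall>y z. (x, y, z) \<in> R \<longrightarrow> dioid_le K (h y \<otimes> f z) c \<and> dioid_le K (h y \<otimes> g z) c)"
    using x c f g h fgh rel_in
    by (simp add: conv_le_iff fun_add_in r_distr add_le_iff cong: imp_cong)
  also have "\<dots> \<longleftrightarrow> dioid_le K ((\<lambda>x\<in>X. (h \<star> f) x \<oplus> (h \<star> g) x) x) c"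
    using x c f g h by (auto simp: conv_le_iff add_le_iff)
  finally show "dioid_le K ((h \<star> (\<lambda>x\<in>X. f x \<oplus> g x)) x) c \<longleftrightarrow>
    dioid_le K ((\<lambda>x\<in>X. (h \<star> f) x \<oplus> (h \<star> g) x) x) c" .
next
  show "h \<star> (\<lambda>x\<in>X. f x \<oplus> g x) \<in> X \<rightarrow>\<^sub>E carrier K"
    by (intro conv_in fun_add_in f g h)
  show "(\<lambda>x\<in>X. (h \<star> f) x \<oplus> (h \<star> g) x) \<in> X \<rightarrow>\<^sub>E carrier K"
    by (rule fun_add_in) (simp_all add: f g h)
qed

lemma zero_conv:
  assumes f: "f \<in> X \<rightarrow>\<^sub>E carrier K"
  shows "(\<lambda>x\<in>X. \<zero>) \<star> f = (\<lambda>x\<in>X. \<zero>)"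
proof (rule function_eqI)
  fix x c assume "x \<in> X" "c \<in> carrier K"
  then show "dioid_le K (((\<lambda>x\<in>X. \<zero>) \<star> f) x) c \<longleftrightarrow> dioid_le K ((\<lambda>x\<in>X. \<zero>) x) c"
    using f PiE_mem[OF f] rel_in by (simp add: conv_le_iff zero_le cong: imp_cong)
qed (use f in simp_all)

lemma conv_zero:
  assumes f: "f \<in> X \<rightarrow>\<^sub>E carrier K"
  shows "f \<star> (\<lambda>x\<in>X. \<zero>) = (\<lambda>x\<in>X. \<zero>)"
proof (rule function_eqI)
  fix x c assume "x \<in> X" "c \<in> carrier K"
  then show "dioid_le K ((f \<star> (\<lambda>x\<in>X. \<zero>)) x) c \<longleftrightarrow> dioid_le K ((\<lambda>x\<in>X. \<zero>) x) c"
    using f PiE_mem[OF f] rel_in by (simp add: conv_le_iff zero_le cong: imp_cong)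
qed (use f in simp_all)

text \<open>
  The algebra \<open>A\<close> is described by its fields so that the statement applies to both reducts
  of the interchange semiring, whatever further record fields are present.
\<close>

lemma dioid_convolution:
  fixes A :: "('x \<Rightarrow> 'a, 'n) ring_scheme"
  assumes assoc: "rel_associative X R" and units: "rel_units X R E"
    and A: "carrier A = X \<rightarrow>\<^sub>E carrier K"
      "mult A = convolution X R K (mult K)"
      "one A = unit_fun X E K"
      "zero A = (\<lambda>x\<in>X. \<zero>)"
      "add A = (\<lambda>f g. \<lambda>x\<in>X. f x \<oplus> g x)"
  shows "dioid A"
proof -
  have "abelian_monoid A"
  proof (rule abelian_monoidI)
    show "\<zero>\<^bsub>A\<^esub> \<in> carrier A" by (simp add: A)
  next
    fix f g assume "f \<in> carrier A" "g \<in> carrier A"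
    then have f: "f \<in> X \<rightarrow>\<^sub>E carrier K" and g: "g \<in> X \<rightarrow>\<^sub>E carrier K" by (simp_all add: A)
    show "f \<oplus>\<^bsub>A\<^esub> g \<in> carrier A"
      using f g by (simp only: A fun_add_in)
    show "f \<oplus>\<^bsub>A\<^esub> g = g \<oplus>\<^bsub>A\<^esub> f"
      using PiE_mem[OF f] PiE_mem[OF g] by (simp add: A a_comm cong: restrict_cong)
    \<comment> \<open>The left side is \<open>f\<close> restricted to \<open>X\<close>, which is
      \<open>f\<close> itself because \<open>f\<close> is extensional.\<close>
    show "\<zero>\<^bsub>A\<^esub> \<oplus>\<^bsub>A\<^esub> f = f"
      using PiE_mem[OF f] PiE_restrict[OF f] by (simp add: A cong: restrict_cong)
    fix h assume "h \<in> carrier A"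
    then have h: "h \<in> X \<rightarrow>\<^sub>E carrier K" by (simp add: A)
    show "f \<oplus>\<^bsub>A\<^esub> g \<oplus>\<^bsub>A\<^esub> h = f \<oplus>\<^bsub>A\<^esub> (g \<oplus>\<^bsub>A\<^esub> h)"
      using PiE_mem[OF f] PiE_mem[OF g] PiE_mem[OF h]
      by (simp add: A a_assoc cong: restrict_cong)
  qed
  moreover have "monoid A"
    by (rule monoidI) (simp_all add: A conv_assoc[OF assoc] unit_conv[OF units] conv_unit[OF units])
  moreover have "f \<oplus>\<^bsub>A\<^esub> f = f" if "f \<in> carrier A" for f
  proof -
    from that have f: "f \<in> X \<rightarrow>\<^sub>E carrier K" by (simp add: A)
    show ?thesis
      using PiE_mem[OF f] PiE_restrict[OF f] by (simp add: A add_idem cong: restrict_cong)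
  qed
  ultimately show ?thesis
    by (intro dioid.intro semiring.intro semiring_axioms.intro dioid_axioms.intro)
      (simp_all add: A conv_distrib_left conv_distrib_right zero_conv conv_zero)
qed

end

section \<open>Independence of sums, convolution, unit and order from the product field\<close>

lemma finsum_mult_update: "finsum (K\<lparr>mult := m\<rparr>) = finsum K"
  by (simp add: finsum_def fun_eq_iff)

text \<open>The product is an explicit argument, and the record contributes only its finite sums.
  Hence facts about the diamond reduct speak of convolutions over \<open>K\<close>.\<close>

lemma convolution_mult_update: "convolution X R (K\<lparr>mult := m\<rparr>) = convolution X R K"
  by (simp add: convolution_def finsum_mult_update fun_eq_iff)

lemma unit_fun_mult_update: "unit_fun X E (K\<lparr>mult := m\<rparr>) = unit_fun X E K"
  unfolding unit_fun_def by (simp cong: if_cong)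

lemma dioid_le_mult_update: "dioid_le (K\<lparr>mult := m\<rparr>) = dioid_le K"
  by (simp add: dioid_le_def fun_eq_iff)

section \<open>The interchange law for the two convolutions\<close>

theorem theorem7p4:
  fixes X :: "'x set" and R S :: "('x \<times> 'x \<times> 'x) set" and E :: "'x set"
    and K :: "('k, 'm) interchange_struct_scheme"
  assumes "rel_interchange_monoid X R S E"
    and "finitely_decomposable X R S"
    and "interchange_semiring K"
  shows "interchange_semiring (convolution_algebra X R S E K)"
proof -
  interpret M: rel_interchange_monoid X R S E by fact
  interpret K: interchange_semiring K by fact
  let ?K' = "K\<lparr>mult := diamond K\<rparr>" and ?A = "convolution_algebra X R S E K"
  \<comment> \<open>\<open>B\<close> and \<open>D\<close> yield the two dioids. \<open>BS\<close>
    pairs the bullet product with the relation \<open>S\<close>, for bullet products whose factors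
    are sums over \<open>S\<close>-decompositions.\<close>
  interpret B: decomposition_dioid K X R
    using assms(2) K.bullet_dioid M.R_on
    by (simp add: decomposition_dioid_def decomposition_dioid_axioms_def finitely_decomposable_def)
  interpret BS: decomposition_dioid K X S
    using assms(2) K.bullet_dioid M.S_on
    by (simp add: decomposition_dioid_def decomposition_dioid_axioms_def finitely_decomposable_def)
  interpret D: decomposition_dioid ?K' X S
    using assms(2) K.diamond_dioid M.S_on
    by (simp add: decomposition_dioid_def decomposition_dioid_axioms_def finitely_decomposable_def)
  note diamond_closed = D.m_closed[simplified]
  note diamond_mono = D.mult_mono[unfolded dioid_le_mult_update, simplified]
  show ?thesis
  proof (rule interchange_semiring.intro)
    show "dioid ?A"
      by (rule B.dioid_convolution[OF M.R_assoc M.R_units]) (simp_all add: convolution_algebra_def)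
    show "dioid (?A\<lparr>mult := diamond ?A\<rparr>)"
      by (rule D.dioid_convolution[OF M.S_assoc M.S_units])
        (simp_all add: convolution_algebra_def convolution_mult_update unit_fun_mult_update)
  next
    fix f g h k
    assume "f \<in> carrier ?A" "g \<in> carrier ?A" "h \<in> carrier ?A" "k \<in> carrier ?A"
    then have fs: "f \<in> X \<rightarrow>\<^sub>E carrier K" "g \<in> X \<rightarrow>\<^sub>E carrier K"
        "h \<in> X \<rightarrow>\<^sub>E carrier K" "k \<in> X \<rightarrow>\<^sub>E carrier K"
      by (simp_all add: convolution_algebra_def)
    note fs_mem = fs[THEN PiE_mem]
    let ?b = "convolution X R K (mult K)" and ?d = "convolution X S K (diamond K)"
    let ?lhs = "?b (?d f g) (?d h k)" and ?rhs = "?d (?b f h) (?b g k)"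
    note d_in = BS.convolution_in[of "diamond K", OF diamond_closed]
      and d_closed = BS.convolution_closed[of "diamond K", OF diamond_closed]
    have rhs_in: "?rhs \<in> X \<rightarrow>\<^sub>E carrier K"
      using fs by (simp add: d_in)
    have "dioid_le K (?lhs x) (?rhs x)" if x: "x \<in> X" for x
    proof -
      have c: "?rhs x \<in> carrier K"
        using rhs_in x by (rule PiE_mem)
      \<comment> \<open>These are the products into which the left side expands: \<open>x\<close> is
        split by \<open>R\<close>, then both parts are split by \<open>S\<close>.\<close>
      have product_le: "dioid_le K ((f t \<diamondop>\<^bsub>K\<^esub> g u) \<otimes>\<^bsub>K\<^esub> (h v \<diamondop>\<^bsub>K\<^esub> k w)) (?rhs x)"
        if yz: "(x, y, z) \<in> R" and tu: "(y, t, u) \<in> S" and vw: "(z, v, w) \<in> S"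
        for y z t u v w
      proof -
        have X: "y \<in> X" "z \<in> X" "t \<in> X" "u \<in> X" "v \<in> X" "w \<in> X"
          using yz tu vw B.rel_in D.rel_in by blast+
        \<comment> \<open>Relational interchange regroups the four points: \<open>p\<close> and
          \<open>q\<close> are the parts of an \<open>S\<close>-decomposition of \<open>x\<close>,
          and each is in turn split by \<open>R\<close>.\<close>
        obtain p q where pq: "(p, t, v) \<in> R" "(x, p, q) \<in> S" "(q, u, w) \<in> R"
          using M.rel_interchange[OF X(3-6) x] X(1,2) yz tu vw by blast
        then have pqX: "p \<in> X" "q \<in> X"
          using B.rel_in by blast+
        have 1: "dioid_le K ((f t \<diamondop>\<^bsub>K\<^esub> g u) \<otimes>\<^bsub>K\<^esub> (h v \<diamondop>\<^bsub>K\<^esub> k w))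
            ((f t \<otimes>\<^bsub>K\<^esub> h v) \<diamondop>\<^bsub>K\<^esub> (g u \<otimes>\<^bsub>K\<^esub> k w))"
          using X fs_mem by (intro K.interchange)
        \<comment> \<open>Each bullet product is a summand of the convolution at \<open>p\<close> or
          \<open>q\<close>, and diamond is monotone in both arguments.\<close>
        have 2: "dioid_le K ((f t \<otimes>\<^bsub>K\<^esub> h v) \<diamondop>\<^bsub>K\<^esub> (g u \<otimes>\<^bsub>K\<^esub> k w))
            (?b f h p \<diamondop>\<^bsub>K\<^esub> ?b g k q)"
          using X fs fs_mem pq pqX
          by (intro diamond_mono B.summand_le_convolution) simp_all
        have 3: "dioid_le K (?b f h p \<diamondop>\<^bsub>K\<^esub> ?b g k q) (?rhs x)"
          using fs pq(2) by (intro BS.summand_le_convolution diamond_closed) simp_all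
        show ?thesis
          by (rule B.le_trans[OF B.le_trans[OF 1 2] 3])
            (use X pqX fs fs_mem c in \<open>simp_all add: diamond_closed\<close>)
      qed
      show ?thesis
        \<comment> \<open>The outer convolution is expanded by \<open>B.conv_le_iff\<close>; the two
          \<open>BS\<close> rules expand the factors of each resulting product.\<close>
        using product_le x c fs fs_mem B.rel_in D.rel_in
        by (simp add: B.conv_le_iff BS.convolution_mult_le_iff BS.mult_convolution_le_iff
            d_in d_closed diamond_closed cong: imp_cong)
    qed
    moreover have "?lhs \<in> X \<rightarrow>\<^sub>E carrier K"
      using fs by (simp add: d_in)
    \<comment> \<open>The order on functions is defined by an equation between extensional
      functions, so the pointwise inequalities are collected into one.\<close>
    ultimately have "(\<lambda>x\<in>X. ?lhs x \<oplus>\<^bsub>K\<^esub> ?rhs x) = ?rhs"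
      using rhs_in by (intro PiE_ext[OF B.fun_add_in rhs_in]) (simp_all add: dioid_le_def)
    then show "dioid_le ?A ((f \<diamondop>\<^bsub>?A\<^esub> g) \<otimes>\<^bsub>?A\<^esub> (h \<diamondop>\<^bsub>?A\<^esub> k))
        ((f \<otimes>\<^bsub>?A\<^esub> h) \<diamondop>\<^bsub>?A\<^esub> (g \<otimes>\<^bsub>?A\<^esub> k))"
      by (simp add: dioid_le_def convolution_algebra_def)
  qed
qed

end
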